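(* Let $\mathcal{Q}$ be a quantaloid and $\mathcal{E}$ a $\mathcal{Q}$-category. An object $X\in\mathcal{E}_0$ is Sierpiński (resp. co-Sierpiński) if, and only if, $$Y=\mathcal{E}(Y,X)\rightarrowtail X\quad(\text{resp. } Y=\mathcal{E}(X,Y)\otimes X)$$ for all $Y\in\mathcal{E}_0$.
   Context: Quantaloids. A quantaloid $\mathcal{Q}$ is a (possibly large) 2-category whose 2-cells are given by order, such that each hom-set $\mathcal{Q}(S,T)$ is a complete lattice and composition preserves joins in each variable. Left and right implications are defined by $v\circ u\le w\iff v\le w\swarrow u\iff u\le v\searrow w$ for $u:S\to T$, $v:T\to U$, $w:S\to U$. Write $\mathcal{Q}_0=\mathrm{ob}\,\mathcal{Q}$. $\mathcal{Q}$-categories. A $\mathcal{Q}$-category $\mathcal{E}$ has a class $\mathcal{E}_0$ of objects, an extent function $|\text{-}|:\mathcal{E}_0\to\mathcal{Q}_0$, and $\mathcal{E}(X,Y)\in\mathcal{Q}(|X|,|Y|)$ with $1_{|X|}\le\mathcal{E}(X,X)$ and $\mathcal{E}(Y,Z)\circ\mathcal{E}(X,Y)\le\mathcal{E}(X,Z)$. A $\mathcal{Q}$-functor $F:\mathcal{D}\to\mathcal{E}$ is a function $F:\mathcal{D}_0\to\mathcal{E}_0$ with $|FX|=|X|$ and $\mathcal{D}(X,Y)\le\mathcal{E}(FX,FY)$. (Co)density. A sink $\sigma$ (resp. source $\tau$) of extent $T\in\mathcal{Q}_0$ on a $\mathcal{Q}$-category $\mathcal{D}$ is a family of $\mathcal{Q}$-arrows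 $\sigma(X):|X|\to T$ (resp. $\tau(X):T\to|X|$), $X\in\mathcal{D}_0$. For a $\mathcal{Q}$-functor $F:\mathcal{D}\to\mathcal{E}$, an object $C\in\mathcal{E}_0$ of extent $T$ is the colimit $\mathrm{colim}_\sigma F$ (resp. limit $\lim_\tau F$) if for all $Y\in\mathcal{E}_0$, $\mathcal{E}(C,Y)=\bigwedge_{X\in\mathcal{D}_0}\mathcal{E}(FX,Y)\swarrow\sigma(X)$ (resp. $\mathcal{E}(Y,C)=\bigwedge_{X\in\mathcal{D}_0}\tau(X)\searrow\mathcal{E}(Y,FX)$). $F$ is dense (resp. codense) if every object of $\mathcal{E}$ is the colimit (resp. limit) of $F$ weighted by some sink (resp. source) on $\mathcal{D}$. An object $X\in\mathcal{E}_0$ is Sierpiński (resp. co-Sierpiński) if the inclusion $\mathcal{Q}$-functor into $\mathcal{E}$ of its one-object full $\mathcal{Q}$-subcategory $\{X\}$ (with hom $\mathcal{E}(X,X)$) is codense (resp. dense). (Co)tensors. For a $\mathcal{Q}$-arrow $f:|X|\to T$ (resp. $g:T\to|X|$), the tensor $f\otimes X$ (resp. cotensor $g\rightarrowtail X$), when it exists, is an object of $\mathcal{E}$ of extent $T$ such that $\mathcal{E}(f\otimes X,Z)=\mathcal{E}(X,Z)\swarrow f$ (resp. $\mathcal{E}(Z,g\rightarrowtail X)=g\searrow\mathcal{E}(Z,X)$) for all $Z\in\mathcal{E}_0$. Such an object is determined only up to the relation $Y\cong Y'$ (equal extents, $1\le\mathcal{E}(Y,Y')$ and $1\le\mathcal{E}(Y',Y)$);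 an equation "$Y=g\rightarrowtail X$" (resp. "$Y=f\otimes X$") means that the cotensor (resp. tensor) exists and that $Y$ satisfies its defining property. *)

theory Defs
  imports "HOL-Algebra.Complete_Lattice"
begin

section \<open>Quantaloids\<close>

text \<open>
  The hom-lattices \<open>qhom Q S T\<close> live on a common type of arrows and need not be disjoint, so
  composition carries the three objects involved: \<open>qcomp Q S T U v u\<close> is the composite
  \<open>v \<circ> u : S \<rightarrow> U\<close> of \<open>u : S \<rightarrow> T\<close> and \<open>v : T \<rightarrow> U\<close>.
\<close>

record ('o, 'a) quantaloid_data =
  qob :: "'o set"
  qhom :: "'o \<Rightarrow> 'o \<Rightarrow> 'a gorder"
  qcomp :: "'o \<Rightarrow> 'o \<Rightarrow> 'o \<Rightarrow> 'a \<Rightarrow> 'a \<Rightarrow> 'a"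
  qid :: "'o \<Rightarrow> 'a"

definition arrows :: "('o, 'a) quantaloid_data \<Rightarrow> 'o \<Rightarrow> 'o \<Rightarrow> 'a set" where
  "arrows Q S T = carrier (qhom Q S T)"

locale quantaloid =
  fixes Q :: "('o, 'a) quantaloid_data"
  assumes hom_complete_lattice:
      "\<lbrakk>S \<in> qob Q; T \<in> qob Q\<rbrakk> \<Longrightarrow> complete_lattice (qhom Q S T)"
    and comp_closed:
      "\<lbrakk>S \<in> qob Q; T \<in> qob Q; U \<in> qob Q; u \<in> arrows Q S T; v \<in> arrows Q T U\<rbrakk>
       \<Longrightarrow> qcomp Q S T U v u \<in> arrows Q S U"
    and comp_assoc:
      "\<lbrakk>R \<in> qob Q; S \<in> qob Q; T \<in> qob Q; U \<in> qob Q;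
        u \<in> arrows Q R S; v \<in> arrows Q S T; w \<in> arrows Q T U\<rbrakk>
       \<Longrightarrow> qcomp Q R S U (qcomp Q S T U w v) u = qcomp Q R T U w (qcomp Q R S T v u)"
    and id_closed: "S \<in> qob Q \<Longrightarrow> qid Q S \<in> arrows Q S S"
    and comp_id_left:
      "\<lbrakk>S \<in> qob Q; T \<in> qob Q; u \<in> arrows Q S T\<rbrakk> \<Longrightarrow> qcomp Q S T T (qid Q T) u = u"
    and comp_id_right:
      "\<lbrakk>S \<in> qob Q; T \<in> qob Q; u \<in> arrows Q S T\<rbrakk> \<Longrightarrow> qcomp Q S S T u (qid Q S) = u"
    and comp_sup_left:
      "\<lbrakk>S \<in> qob Q; T \<in> qob Q; U \<in> qob Q; A \<subseteq> arrows Q T U; u \<in> arrows Q S T\<rbrakk>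
       \<Longrightarrow> qcomp Q S T U (\<Squnion>\<^bsub>qhom Q T U\<^esub> A) u
           = \<Squnion>\<^bsub>qhom Q S U\<^esub> ((\<lambda>v. qcomp Q S T U v u) ` A)"
    and comp_sup_right:
      "\<lbrakk>S \<in> qob Q; T \<in> qob Q; U \<in> qob Q; v \<in> arrows Q T U; A \<subseteq> arrows Q S T\<rbrakk>
       \<Longrightarrow> qcomp Q S T U v (\<Squnion>\<^bsub>qhom Q S T\<^esub> A)
           = \<Squnion>\<^bsub>qhom Q S U\<^esub> ((\<lambda>u. qcomp Q S T U v u) ` A)"

text \<open>
  For \<open>u : S \<rightarrow> T\<close>, \<open>v : T \<rightarrow> U\<close> and \<open>w : S \<rightarrow> U\<close>, \<open>left_imp Q S T U w u\<close> is
  \<open>w \<swarrow> u : T \<rightarrow> U\<close> and \<open>right_imp Q S T U v w\<close> is \<open>v \<searrow> w : S \<rightarrow> T\<close>.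
  The lemmas \<open>left_imp\<close> and \<open>right_imp\<close> below show that in a quantaloid the
  descriptions denote.
\<close>

definition left_imp :: "('o, 'a) quantaloid_data \<Rightarrow> 'o \<Rightarrow> 'o \<Rightarrow> 'o \<Rightarrow> 'a \<Rightarrow> 'a \<Rightarrow> 'a" where
  "left_imp Q S T U w u =
    (THE x. x \<in> arrows Q T U \<and>
      (\<forall>v \<in> arrows Q T U. qcomp Q S T U v u \<sqsubseteq>\<^bsub>qhom Q S U\<^esub> w \<longleftrightarrow> v \<sqsubseteq>\<^bsub>qhom Q T U\<^esub> x))"

definition right_imp :: "('o, 'a) quantaloid_data \<Rightarrow> 'o \<Rightarrow> 'o \<Rightarrow> 'o \<Rightarrow> 'a \<Rightarrow> 'a \<Rightarrow> 'a" where
  "right_imp Q S T U v w =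
    (THE x. x \<in> arrows Q S T \<and>
      (\<forall>u \<in> arrows Q S T. qcomp Q S T U v u \<sqsubseteq>\<^bsub>qhom Q S U\<^esub> w \<longleftrightarrow> u \<sqsubseteq>\<^bsub>qhom Q S T\<^esub> x))"

lemma residual_exists:
  assumes K: "complete_lattice K" and L: "complete_lattice L"
    and f: "\<And>x. x \<in> carrier K \<Longrightarrow> f x \<in> carrier L"
    and f_sup: "\<And>A. A \<subseteq> carrier K \<Longrightarrow> f (\<Squnion>\<^bsub>K\<^esub> A) = \<Squnion>\<^bsub>L\<^esub> (f ` A)"
    and w: "w \<in> carrier L"
  shows "\<exists>!x. x \<in> carrier K \<and> (\<forall>v \<in> carrier K. f v \<sqsubseteq>\<^bsub>L\<^esub> w \<longleftrightarrow> v \<sqsubseteq>\<^bsub>K\<^esub> x)"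
proof -
  interpret K: complete_lattice K by (rule K)
  interpret L: complete_lattice L by (rule L)
  define A where "A = {v \<in> carrier K. f v \<sqsubseteq>\<^bsub>L\<^esub> w}"
  define s where "s = \<Squnion>\<^bsub>K\<^esub> A"
  have A: "A \<subseteq> carrier K" by (auto simp: A_def)
  have s: "s \<in> carrier K" unfolding s_def using A by simp
  have fA: "f ` A \<subseteq> carrier L" using A f by auto
  have fs: "f s \<sqsubseteq>\<^bsub>L\<^esub> w"
    unfolding s_def f_sup[OF A]
    by (rule L.sup_least[OF fA]) (auto simp: A_def w)
  have mono: "f v \<sqsubseteq>\<^bsub>L\<^esub> f s" if v: "v \<in> carrier K" "v \<sqsubseteq>\<^bsub>K\<^esub> s" for v
  proof -
    have vs: "{v, s} \<subseteq> carrier K" using v s by auto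
    have "\<Squnion>\<^bsub>K\<^esub> {v, s} = s"
    proof (rule K.le_antisym)
      show "\<Squnion>\<^bsub>K\<^esub> {v, s} \<sqsubseteq>\<^bsub>K\<^esub> s" by (rule K.sup_least[OF vs]) (auto simp: v s)
      show "s \<sqsubseteq>\<^bsub>K\<^esub> \<Squnion>\<^bsub>K\<^esub> {v, s}" by (rule K.sup_upper[OF vs]) auto
    qed (use s vs in auto)
    then have "f s = \<Squnion>\<^bsub>L\<^esub> (f ` {v, s})" using f_sup[OF vs] by simp
    moreover have "f v \<sqsubseteq>\<^bsub>L\<^esub> \<Squnion>\<^bsub>L\<^esub> (f ` {v, s})"
      by (rule L.sup_upper) (use f v s in auto)
    ultimately show ?thesis by simp
  qed
  have adj: "\<forall>v \<in> carrier K. f v \<sqsubseteq>\<^bsub>L\<^esub> w \<longleftrightarrow> v \<sqsubseteq>\<^bsub>K\<^esub> s"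
  proof (intro ballI iffI)
    fix v assume "v \<in> carrier K" "f v \<sqsubseteq>\<^bsub>L\<^esub> w"
    then show "v \<sqsubseteq>\<^bsub>K\<^esub> s" unfolding s_def using A by (intro K.sup_upper) (auto simp: A_def)
  next
    fix v assume v: "v \<in> carrier K" "v \<sqsubseteq>\<^bsub>K\<^esub> s"
    show "f v \<sqsubseteq>\<^bsub>L\<^esub> w" by (rule L.le_trans[OF mono[OF v] fs]) (use f v s w in auto)
  qed
  show ?thesis
  proof (rule ex1I[of _ s])
    fix x assume x: "x \<in> carrier K \<and> (\<forall>v \<in> carrier K. f v \<sqsubseteq>\<^bsub>L\<^esub> w \<longleftrightarrow> v \<sqsubseteq>\<^bsub>K\<^esub> x)"
    show "x = s" by (rule K.le_antisym) (use x s adj in auto)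
  qed (use s adj in auto)
qed

lemma (in quantaloid) left_imp:
  assumes "S \<in> qob Q" "T \<in> qob Q" "U \<in> qob Q" "u \<in> arrows Q S T" "w \<in> arrows Q S U"
  shows "left_imp Q S T U w u \<in> arrows Q T U"
    and "v \<in> arrows Q T U \<Longrightarrow>
      qcomp Q S T U v u \<sqsubseteq>\<^bsub>qhom Q S U\<^esub> w \<longleftrightarrow> v \<sqsubseteq>\<^bsub>qhom Q T U\<^esub> left_imp Q S T U w u"
proof -
  have "\<exists>!x. x \<in> arrows Q T U \<and>
      (\<forall>v \<in> arrows Q T U. qcomp Q S T U v u \<sqsubseteq>\<^bsub>qhom Q S U\<^esub> w \<longleftrightarrow> v \<sqsubseteq>\<^bsub>qhom Q T U\<^esub> x)"
    unfolding arrows_def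
    by (rule residual_exists)
      (use assms hom_complete_lattice comp_closed comp_sup_left in \<open>auto simp: arrows_def\<close>)
  from theI'[OF this] show "left_imp Q S T U w u \<in> arrows Q T U"
    and "v \<in> arrows Q T U \<Longrightarrow>
      qcomp Q S T U v u \<sqsubseteq>\<^bsub>qhom Q S U\<^esub> w \<longleftrightarrow> v \<sqsubseteq>\<^bsub>qhom Q T U\<^esub> left_imp Q S T U w u"
    unfolding left_imp_def by blast+
qed

lemma (in quantaloid) right_imp:
  assumes "S \<in> qob Q" "T \<in> qob Q" "U \<in> qob Q" "v \<in> arrows Q T U" "w \<in> arrows Q S U"
  shows "right_imp Q S T U v w \<in> arrows Q S T"
    and "u \<in> arrows Q S T \<Longrightarrow>
      qcomp Q S T U v u \<sqsubseteq>\<^bsub>qhom Q S U\<^esub> w \<longleftrightarrow> u \<sqsubseteq>\<^bsub>qhom Q S T\<^esub> right_imp Q S T U v w"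
proof -
  have "\<exists>!x. x \<in> arrows Q S T \<and>
      (\<forall>u \<in> arrows Q S T. qcomp Q S T U v u \<sqsubseteq>\<^bsub>qhom Q S U\<^esub> w \<longleftrightarrow> u \<sqsubseteq>\<^bsub>qhom Q S T\<^esub> x)"
    unfolding arrows_def
    by (rule residual_exists)
      (use assms hom_complete_lattice comp_closed comp_sup_right in \<open>auto simp: arrows_def\<close>)
  from theI'[OF this] show "right_imp Q S T U v w \<in> arrows Q S T"
    and "u \<in> arrows Q S T \<Longrightarrow>
      qcomp Q S T U v u \<sqsubseteq>\<^bsub>qhom Q S U\<^esub> w \<longleftrightarrow> u \<sqsubseteq>\<^bsub>qhom Q S T\<^esub> right_imp Q S T U v w"
    unfolding right_imp_def by blast+
qed


section \<open>Categories and functors enriched in a quantaloid\<close>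

record ('e, 'o, 'a) qcategory_data =
  ob :: "'e set"
  ext :: "'e \<Rightarrow> 'o"
  ehom :: "'e \<Rightarrow> 'e \<Rightarrow> 'a"

locale qcategory = quantaloid Q
  for Q :: "('o, 'a) quantaloid_data" and E :: "('e, 'o, 'a) qcategory_data" +
  assumes ext_closed: "X \<in> ob E \<Longrightarrow> ext E X \<in> qob Q"
    and ehom_closed:
      "\<lbrakk>X \<in> ob E; Y \<in> ob E\<rbrakk> \<Longrightarrow> ehom E X Y \<in> arrows Q (ext E X) (ext E Y)"
    and ehom_id:
      "X \<in> ob E \<Longrightarrow> qid Q (ext E X) \<sqsubseteq>\<^bsub>qhom Q (ext E X) (ext E X)\<^esub> ehom E X X"
    and ehom_comp:
      "\<lbrakk>X \<in> ob E; Y \<in> ob E; Z \<in> ob E\<rbrakk>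
       \<Longrightarrow> qcomp Q (ext E X) (ext E Y) (ext E Z) (ehom E Y Z) (ehom E X Y)
           \<sqsubseteq>\<^bsub>qhom Q (ext E X) (ext E Z)\<^esub> ehom E X Z"

locale qfunctor = D: qcategory Q D + E: qcategory Q E
  for Q :: "('o, 'a) quantaloid_data"
    and D :: "('d, 'o, 'a) qcategory_data"
    and E :: "('e, 'o, 'a) qcategory_data"
    and F :: "'d \<Rightarrow> 'e" +
  assumes map_closed: "X \<in> ob D \<Longrightarrow> F X \<in> ob E"
    and map_ext: "X \<in> ob D \<Longrightarrow> ext E (F X) = ext D X"
    and map_ehom:
      "\<lbrakk>X \<in> ob D; Y \<in> ob D\<rbrakk>
       \<Longrightarrow> ehom D X Y \<sqsubseteq>\<^bsub>qhom Q (ext D X) (ext D Y)\<^esub> ehom E (F X) (F Y)"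

definition full_subcategory ::
    "('e, 'o, 'a) qcategory_data \<Rightarrow> 'e set \<Rightarrow> ('e, 'o, 'a) qcategory_data" where
  "full_subcategory E A = E\<lparr>ob := A\<rparr>"

lemma (in qcategory) inclusion_qfunctor:
  assumes "A \<subseteq> ob E"
  shows "qfunctor Q (full_subcategory E A) E (\<lambda>X. X)"
proof -
  have sub: "X \<in> A \<Longrightarrow> X \<in> ob E" for X using assms by auto
  have D: "qcategory Q (full_subcategory E A)"
    by unfold_locales
      (auto simp: full_subcategory_def ext_closed ehom_closed ehom_id ehom_comp sub)
  have refl: "ehom E X Y \<sqsubseteq>\<^bsub>qhom Q (ext E X) (ext E Y)\<^esub> ehom E X Y"
    if "X \<in> ob E" "Y \<in> ob E" for X Y
  proof -
    interpret H: complete_lattice "qhom Q (ext E X) (ext E Y)"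
      by (rule hom_complete_lattice) (use that ext_closed in auto)
    show ?thesis using ehom_closed[OF that] by (simp add: arrows_def)
  qed
  show ?thesis
    by (intro qfunctor.intro D qcategory_axioms qfunctor_axioms.intro)
      (auto simp: full_subcategory_def sub refl)
qed


section \<open>Weighted limits and colimits, density\<close>

definition is_sink ::
    "('o, 'a) quantaloid_data \<Rightarrow> ('d, 'o, 'a) qcategory_data \<Rightarrow> 'o \<Rightarrow> ('d \<Rightarrow> 'a) \<Rightarrow> bool" where
  "is_sink Q D T \<sigma> \<longleftrightarrow> T \<in> qob Q \<and> (\<forall>X \<in> ob D. \<sigma> X \<in> arrows Q (ext D X) T)"

definition is_source ::
    "('o, 'a) quantaloid_data \<Rightarrow> ('d, 'o, 'a) qcategory_data \<Rightarrow> 'o \<Rightarrow> ('d \<Rightarrow> 'a) \<Rightarrow> bool" where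
  "is_source Q D T \<tau> \<longleftrightarrow> T \<in> qob Q \<and> (\<forall>X \<in> ob D. \<tau> X \<in> arrows Q T (ext D X))"

definition is_colimit ::
    "('o, 'a) quantaloid_data \<Rightarrow> ('d, 'o, 'a) qcategory_data \<Rightarrow> ('e, 'o, 'a) qcategory_data
     \<Rightarrow> ('d \<Rightarrow> 'e) \<Rightarrow> 'o \<Rightarrow> ('d \<Rightarrow> 'a) \<Rightarrow> 'e \<Rightarrow> bool" where
  "is_colimit Q D E F T \<sigma> C \<longleftrightarrow>
    C \<in> ob E \<and> ext E C = T \<and>
    (\<forall>Y \<in> ob E. ehom E C Y =
      \<Sqinter>\<^bsub>qhom Q T (ext E Y)\<^esub>
        ((\<lambda>X. left_imp Q (ext D X) T (ext E Y) (ehom E (F X) Y) (\<sigma> X)) ` ob D))"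

definition is_limit ::
    "('o, 'a) quantaloid_data \<Rightarrow> ('d, 'o, 'a) qcategory_data \<Rightarrow> ('e, 'o, 'a) qcategory_data
     \<Rightarrow> ('d \<Rightarrow> 'e) \<Rightarrow> 'o \<Rightarrow> ('d \<Rightarrow> 'a) \<Rightarrow> 'e \<Rightarrow> bool" where
  "is_limit Q D E F T \<tau> C \<longleftrightarrow>
    C \<in> ob E \<and> ext E C = T \<and>
    (\<forall>Y \<in> ob E. ehom E Y C =
      \<Sqinter>\<^bsub>qhom Q (ext E Y) T\<^esub>
        ((\<lambda>X. right_imp Q (ext E Y) T (ext D X) (\<tau> X) (ehom E Y (F X))) ` ob D))"

definition dense_functor ::
    "('o, 'a) quantaloid_data \<Rightarrow> ('d, 'o, 'a) qcategory_data \<Rightarrow> ('e, 'o, 'a) qcategory_data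
     \<Rightarrow> ('d \<Rightarrow> 'e) \<Rightarrow> bool" where
  "dense_functor Q D E F \<longleftrightarrow>
    qfunctor Q D E F \<and> (\<forall>C \<in> ob E. \<exists>T \<sigma>. is_sink Q D T \<sigma> \<and> is_colimit Q D E F T \<sigma> C)"

definition codense_functor ::
    "('o, 'a) quantaloid_data \<Rightarrow> ('d, 'o, 'a) qcategory_data \<Rightarrow> ('e, 'o, 'a) qcategory_data
     \<Rightarrow> ('d \<Rightarrow> 'e) \<Rightarrow> bool" where
  "codense_functor Q D E F \<longleftrightarrow>
    qfunctor Q D E F \<and> (\<forall>C \<in> ob E. \<exists>T \<tau>. is_source Q D T \<tau> \<and> is_limit Q D E F T \<tau> C)"

definition sierpinski ::
    "('o, 'a) quantaloid_data \<Rightarrow> ('e, 'o, 'a) qcategory_data \<Rightarrow> 'e \<Rightarrow> bool" where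
  "sierpinski Q E X \<longleftrightarrow> codense_functor Q (full_subcategory E {X}) E (\<lambda>Y. Y)"

definition co_sierpinski ::
    "('o, 'a) quantaloid_data \<Rightarrow> ('e, 'o, 'a) qcategory_data \<Rightarrow> 'e \<Rightarrow> bool" where
  "co_sierpinski Q E X \<longleftrightarrow> dense_functor Q (full_subcategory E {X}) E (\<lambda>Y. Y)"


section \<open>Tensors and cotensors\<close>

text \<open>
  As tensors and cotensors are determined only up to isomorphism, the equations
  \<open>W = f \<otimes> X\<close> and \<open>W = g \<rightarrowtail> X\<close> become predicates: \<open>W\<close> has the
  defining property. The argument \<open>T\<close> is the codomain of \<open>f : |X| \<rightarrow> T\<close>,
  respectively the domain of \<open>g : T \<rightarrow> |X|\<close>.
\<close>

definition is_tensor ::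
    "('o, 'a) quantaloid_data \<Rightarrow> ('e, 'o, 'a) qcategory_data \<Rightarrow> 'o \<Rightarrow> 'a \<Rightarrow> 'e \<Rightarrow> 'e \<Rightarrow> bool" where
  "is_tensor Q E T f X W \<longleftrightarrow>
    W \<in> ob E \<and> ext E W = T \<and>
    (\<forall>Z \<in> ob E. ehom E W Z = left_imp Q (ext E X) T (ext E Z) (ehom E X Z) f)"

definition is_cotensor ::
    "('o, 'a) quantaloid_data \<Rightarrow> ('e, 'o, 'a) qcategory_data \<Rightarrow> 'o \<Rightarrow> 'a \<Rightarrow> 'e \<Rightarrow> 'e \<Rightarrow> bool" where
  "is_cotensor Q E T g X W \<longleftrightarrow>
    W \<in> ob E \<and> ext E W = T \<and>
    (\<forall>Z \<in> ob E. ehom E Z W = right_imp Q (ext E Z) T (ext E X) g (ehom E Z X))"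

end

theory Submission
  imports Defs
begin

text \<open>
  A source on the one-object subcategory \<open>{X}\<close> is a single arrow \<open>g : T \<rightarrow> |X|\<close>, and the limit it
  weights is the cotensor \<open>g \<rightarrowtail> X\<close>, because a meet over one object is trivial. So \<open>X\<close> is Sierpinski
  just when every \<open>Y\<close> is \<open>g \<rightarrowtail> X\<close> for some \<open>g\<close>, and what remains is that \<open>g\<close> may always be replaced
  by \<open>\<E>(Y,X)\<close>, the largest possible weight. Indeed \<open>1 \<le> \<E>(Y,Y) = g \<searrow> \<E>(Y,X)\<close> gives
  \<open>g \<le> \<E>(Y,X)\<close>, hence for every \<open>Z\<close>
  \<open>\<E>(Z,Y) \<le> \<E>(Y,X) \<searrow> \<E>(Z,X) \<le> g \<searrow> \<E>(Z,X) = \<E>(Z,Y)\<close>,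
  where the first inequality is the composition law of \<open>\<E>\<close> and the second is antitonicity of
  implication in the weight; so all of these are equal. The argument for tensors is the dual one,
  with \<open>\<E>(X,Y)\<close> as the largest weight. The lemmas \<open>cotensor_by_hom\<close> and \<open>tensor_by_hom\<close> carry
  it out.
\<close>

context quantaloid
begin

lemma hom_le_trans:
  assumes "S \<in> qob Q" "T \<in> qob Q" "u \<in> arrows Q S T" "v \<in> arrows Q S T" "w \<in> arrows Q S T"
    and "u \<sqsubseteq>\<^bsub>qhom Q S T\<^esub> v" "v \<sqsubseteq>\<^bsub>qhom Q S T\<^esub> w"
  shows "u \<sqsubseteq>\<^bsub>qhom Q S T\<^esub> w"
proof -
  interpret H: complete_lattice "qhom Q S T" by (rule hom_complete_lattice[OF assms(1,2)])
  show ?thesis by (rule H.le_trans[OF assms(6,7)]) (use assms(3-5) in \<open>auto simp: arrows_def\<close>)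
qed

lemma hom_le_antisym:
  assumes "S \<in> qob Q" "T \<in> qob Q" "u \<in> arrows Q S T" "v \<in> arrows Q S T"
    and "u \<sqsubseteq>\<^bsub>qhom Q S T\<^esub> v" "v \<sqsubseteq>\<^bsub>qhom Q S T\<^esub> u"
  shows "u = v"
proof -
  interpret H: complete_lattice "qhom Q S T" by (rule hom_complete_lattice[OF assms(1,2)])
  show ?thesis by (rule H.le_antisym[OF assms(5,6)]) (use assms(3,4) in \<open>auto simp: arrows_def\<close>)
qed

lemma hom_le_refl:
  assumes "S \<in> qob Q" "T \<in> qob Q" "u \<in> arrows Q S T"
  shows "u \<sqsubseteq>\<^bsub>qhom Q S T\<^esub> u"
proof -
  interpret H: complete_lattice "qhom Q S T" by (rule hom_complete_lattice[OF assms(1,2)])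
  show ?thesis using assms(3) by (simp add: arrows_def)
qed

lemma hom_inf_singleton:
  assumes "S \<in> qob Q" "T \<in> qob Q" "u \<in> arrows Q S T"
  shows "\<Sqinter>\<^bsub>qhom Q S T\<^esub> {u} = u"
proof -
  interpret H: complete_lattice "qhom Q S T" by (rule hom_complete_lattice[OF assms(1,2)])
  have u: "u \<in> carrier (qhom Q S T)" using assms(3) by (simp add: arrows_def)
  show ?thesis
    by (rule H.le_antisym) (use u in \<open>auto intro: H.inf_lower H.inf_greatest\<close>)
qed

text \<open>
  Composition is monotone because it is residuated:
  \<open>v' \<circ> u \<le> v' \<circ> u\<close> transposes to \<open>v' \<le> (v' \<circ> u) \<swarrow> u\<close>, so every \<open>v \<le> v'\<close> also lies below
  this implication, and transposing back gives the claim.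
\<close>

lemma comp_mono_left:
  assumes "S \<in> qob Q" "T \<in> qob Q" "U \<in> qob Q"
    and "u \<in> arrows Q S T" "v \<in> arrows Q T U" "v' \<in> arrows Q T U"
    and "v \<sqsubseteq>\<^bsub>qhom Q T U\<^esub> v'"
  shows "qcomp Q S T U v u \<sqsubseteq>\<^bsub>qhom Q S U\<^esub> qcomp Q S T U v' u"
proof -
  let ?w = "qcomp Q S T U v' u"
  have w: "?w \<in> arrows Q S U" by (rule comp_closed) (use assms in auto)
  note adj = left_imp[OF assms(1-4) w]
  have "v' \<sqsubseteq>\<^bsub>qhom Q T U\<^esub> left_imp Q S T U ?w u"
    using adj(2)[OF assms(6)] hom_le_refl[OF assms(1,3) w] by simp
  then have "v \<sqsubseteq>\<^bsub>qhom Q T U\<^esub> left_imp Q S T U ?w u"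
    using hom_le_trans[OF assms(2,3,5,6) adj(1)] assms(7) by simp
  then show ?thesis using adj(2)[OF assms(5)] by simp
qed

lemma comp_mono_right:
  assumes "S \<in> qob Q" "T \<in> qob Q" "U \<in> qob Q"
    and "u \<in> arrows Q S T" "u' \<in> arrows Q S T" "v \<in> arrows Q T U"
    and "u \<sqsubseteq>\<^bsub>qhom Q S T\<^esub> u'"
  shows "qcomp Q S T U v u \<sqsubseteq>\<^bsub>qhom Q S U\<^esub> qcomp Q S T U v u'"
proof -
  let ?w = "qcomp Q S T U v u'"
  have w: "?w \<in> arrows Q S U" by (rule comp_closed) (use assms in auto)
  note adj = right_imp[OF assms(1-3,6) w]
  have "u' \<sqsubseteq>\<^bsub>qhom Q S T\<^esub> right_imp Q S T U v ?w"
    using adj(2)[OF assms(5)] hom_le_refl[OF assms(1,3) w] by simp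
  then have "u \<sqsubseteq>\<^bsub>qhom Q S T\<^esub> right_imp Q S T U v ?w"
    using hom_le_trans[OF assms(1,2,4,5) adj(1)] assms(7) by simp
  then show ?thesis using adj(2)[OF assms(4)] by simp
qed

lemma right_imp_antitone:
  assumes "S \<in> qob Q" "T \<in> qob Q" "U \<in> qob Q"
    and "v \<in> arrows Q T U" "v' \<in> arrows Q T U" "w \<in> arrows Q S U"
    and "v \<sqsubseteq>\<^bsub>qhom Q T U\<^esub> v'"
  shows "right_imp Q S T U v' w \<sqsubseteq>\<^bsub>qhom Q S T\<^esub> right_imp Q S T U v w"
proof -
  let ?x = "right_imp Q S T U v' w"
  note adj = right_imp[OF assms(1-3,4,6)] and adj' = right_imp[OF assms(1-3,5,6)]
  have "qcomp Q S T U v' ?x \<sqsubseteq>\<^bsub>qhom Q S U\<^esub> w"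
    using adj'(2)[OF adj'(1)] hom_le_refl[OF assms(1,2) adj'(1)] by simp
  moreover have "qcomp Q S T U v ?x \<sqsubseteq>\<^bsub>qhom Q S U\<^esub> qcomp Q S T U v' ?x"
    by (rule comp_mono_left) (use assms adj'(1) in auto)
  ultimately have "qcomp Q S T U v ?x \<sqsubseteq>\<^bsub>qhom Q S U\<^esub> w"
    using hom_le_trans[OF assms(1,3) _ _ assms(6)] comp_closed[OF assms(1-3) adj'(1)] assms(4,5)
    by blast
  then show ?thesis using adj(2)[OF adj'(1)] by simp
qed

lemma left_imp_antitone:
  assumes "S \<in> qob Q" "T \<in> qob Q" "U \<in> qob Q"
    and "u \<in> arrows Q S T" "u' \<in> arrows Q S T" "w \<in> arrows Q S U"
    and "u \<sqsubseteq>\<^bsub>qhom Q S T\<^esub> u'"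
  shows "left_imp Q S T U w u' \<sqsubseteq>\<^bsub>qhom Q T U\<^esub> left_imp Q S T U w u"
proof -
  let ?x = "left_imp Q S T U w u'"
  note adj = left_imp[OF assms(1-3,4,6)] and adj' = left_imp[OF assms(1-3,5,6)]
  have "qcomp Q S T U ?x u' \<sqsubseteq>\<^bsub>qhom Q S U\<^esub> w"
    using adj'(2)[OF adj'(1)] hom_le_refl[OF assms(2,3) adj'(1)] by simp
  moreover have "qcomp Q S T U ?x u \<sqsubseteq>\<^bsub>qhom Q S U\<^esub> qcomp Q S T U ?x u'"
    by (rule comp_mono_right) (use assms adj'(1) in auto)
  ultimately have "qcomp Q S T U ?x u \<sqsubseteq>\<^bsub>qhom Q S U\<^esub> w"
    using hom_le_trans[OF assms(1,3) _ _ assms(6)] comp_closed[OF assms(1-3) _ adj'(1)] assms(4,5)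
    by blast
  then show ?thesis using adj(2)[OF adj'(1)] by simp
qed

end

context qcategory
begin

lemma is_limit_singleton_iff_cotensor:
  assumes X: "X \<in> ob E" and T: "T \<in> qob Q" and g: "\<tau> X \<in> arrows Q T (ext E X)"
  shows "is_limit Q (full_subcategory E {X}) E (\<lambda>Y. Y) T \<tau> C
    \<longleftrightarrow> is_cotensor Q E T (\<tau> X) X C"
proof -
  have "\<Sqinter>\<^bsub>qhom Q (ext E Z) T\<^esub> {right_imp Q (ext E Z) T (ext E X) (\<tau> X) (ehom E Z X)}
      = right_imp Q (ext E Z) T (ext E X) (\<tau> X) (ehom E Z X)" if Z: "Z \<in> ob E" for Z
    using ext_closed[OF Z] T right_imp(1)[OF ext_closed[OF Z] T ext_closed[OF X] g ehom_closed[OF Z X]]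
    by (rule hom_inf_singleton)
  then show ?thesis
    by (auto simp: is_limit_def is_cotensor_def full_subcategory_def)
qed

lemma is_colimit_singleton_iff_tensor:
  assumes X: "X \<in> ob E" and T: "T \<in> qob Q" and f: "\<sigma> X \<in> arrows Q (ext E X) T"
  shows "is_colimit Q (full_subcategory E {X}) E (\<lambda>Y. Y) T \<sigma> C
    \<longleftrightarrow> is_tensor Q E T (\<sigma> X) X C"
proof -
  have "\<Sqinter>\<^bsub>qhom Q T (ext E Z)\<^esub> {left_imp Q (ext E X) T (ext E Z) (ehom E X Z) (\<sigma> X)}
      = left_imp Q (ext E X) T (ext E Z) (ehom E X Z) (\<sigma> X)" if Z: "Z \<in> ob E" for Z
    using T ext_closed[OF Z] left_imp(1)[OF ext_closed[OF X] T ext_closed[OF Z] f ehom_closed[OF X Z]]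
    by (rule hom_inf_singleton)
  then show ?thesis
    by (auto simp: is_colimit_def is_tensor_def full_subcategory_def)
qed

lemma sierpinski_iff_all_cotensors:
  assumes X: "X \<in> ob E"
  shows "sierpinski Q E X \<longleftrightarrow>
    (\<forall>Y \<in> ob E. \<exists>g \<in> arrows Q (ext E Y) (ext E X). is_cotensor Q E (ext E Y) g X Y)"
    (is "?L \<longleftrightarrow> ?R")
proof
  assume L: ?L
  show ?R
  proof
    fix Y assume "Y \<in> ob E"
    then obtain T \<tau> where s: "is_source Q (full_subcategory E {X}) T \<tau>"
      and l: "is_limit Q (full_subcategory E {X}) E (\<lambda>Y. Y) T \<tau> Y"
      using L unfolding sierpinski_def codense_functor_def by blast
    have g: "T \<in> qob Q" "\<tau> X \<in> arrows Q T (ext E X)"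
      using s by (auto simp: is_source_def full_subcategory_def)
    moreover have "ext E Y = T" using l by (simp add: is_limit_def)
    ultimately show "\<exists>g \<in> arrows Q (ext E Y) (ext E X). is_cotensor Q E (ext E Y) g X Y"
      using l is_limit_singleton_iff_cotensor[of X T \<tau> Y, OF X g] by auto
  qed
next
  assume R: ?R
  have "\<exists>T \<tau>. is_source Q (full_subcategory E {X}) T \<tau>
      \<and> is_limit Q (full_subcategory E {X}) E (\<lambda>Y. Y) T \<tau> Y" if Y: "Y \<in> ob E" for Y
  proof -
    obtain g where g: "g \<in> arrows Q (ext E Y) (ext E X)" and c: "is_cotensor Q E (ext E Y) g X Y"
      using R Y by blast
    have "is_source Q (full_subcategory E {X}) (ext E Y) (\<lambda>_. g)"
      using g ext_closed[OF Y] by (simp add: is_source_def full_subcategory_def)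
    moreover have "is_limit Q (full_subcategory E {X}) E (\<lambda>Y. Y) (ext E Y) (\<lambda>_. g) Y"
      using is_limit_singleton_iff_cotensor[OF X ext_closed[OF Y], of "\<lambda>_. g"] g c by simp
    ultimately show ?thesis by blast
  qed
  then show ?L
    using inclusion_qfunctor[of "{X}"] X by (simp add: sierpinski_def codense_functor_def)
qed

lemma co_sierpinski_iff_all_tensors:
  assumes X: "X \<in> ob E"
  shows "co_sierpinski Q E X \<longleftrightarrow>
    (\<forall>Y \<in> ob E. \<exists>f \<in> arrows Q (ext E X) (ext E Y). is_tensor Q E (ext E Y) f X Y)"
    (is "?L \<longleftrightarrow> ?R")
proof
  assume L: ?L
  show ?R
  proof
    fix Y assume "Y \<in> ob E"
    then obtain T \<sigma> where s: "is_sink Q (full_subcategory E {X}) T \<sigma>"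
      and l: "is_colimit Q (full_subcategory E {X}) E (\<lambda>Y. Y) T \<sigma> Y"
      using L unfolding co_sierpinski_def dense_functor_def by blast
    have f: "T \<in> qob Q" "\<sigma> X \<in> arrows Q (ext E X) T"
      using s by (auto simp: is_sink_def full_subcategory_def)
    moreover have "ext E Y = T" using l by (simp add: is_colimit_def)
    ultimately show "\<exists>f \<in> arrows Q (ext E X) (ext E Y). is_tensor Q E (ext E Y) f X Y"
      using l is_colimit_singleton_iff_tensor[of X T \<sigma> Y, OF X f] by auto
  qed
next
  assume R: ?R
  have "\<exists>T \<sigma>. is_sink Q (full_subcategory E {X}) T \<sigma>
      \<and> is_colimit Q (full_subcategory E {X}) E (\<lambda>Y. Y) T \<sigma> Y" if Y: "Y \<in> ob E" for Y
  proof -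
    obtain f where f: "f \<in> arrows Q (ext E X) (ext E Y)" and c: "is_tensor Q E (ext E Y) f X Y"
      using R Y by blast
    have "is_sink Q (full_subcategory E {X}) (ext E Y) (\<lambda>_. f)"
      using f ext_closed[OF Y] by (simp add: is_sink_def full_subcategory_def)
    moreover have "is_colimit Q (full_subcategory E {X}) E (\<lambda>Y. Y) (ext E Y) (\<lambda>_. f) Y"
      using is_colimit_singleton_iff_tensor[OF X ext_closed[OF Y], of "\<lambda>_. f"] f c by simp
    ultimately show ?thesis by blast
  qed
  then show ?L
    using inclusion_qfunctor[of "{X}"] X by (simp add: co_sierpinski_def dense_functor_def)
qed

text \<open>
  The unit of \<open>Y\<close> transposes to \<open>g \<le> \<E>(Y,X)\<close>. Passing to the larger weight can only shrink the
  implication, and the composition law shows that it does not shrink below \<open>\<E>(Z,Y)\<close>.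
\<close>

lemma cotensor_by_hom:
  assumes X: "X \<in> ob E" and Y: "Y \<in> ob E"
    and g: "g \<in> arrows Q (ext E Y) (ext E X)"
    and c: "is_cotensor Q E (ext E Y) g X Y"
  shows "is_cotensor Q E (ext E Y) (ehom E Y X) X Y"
proof -
  have hom: "ehom E Z Y = right_imp Q (ext E Z) (ext E Y) (ext E X) g (ehom E Z X)"
    if "Z \<in> ob E" for Z
    using c that by (simp add: is_cotensor_def)
  note oX = ext_closed[OF X] and oY = ext_closed[OF Y] and hYX = ehom_closed[OF Y X]
  have "qcomp Q (ext E Y) (ext E Y) (ext E X) g (qid Q (ext E Y))
      \<sqsubseteq>\<^bsub>qhom Q (ext E Y) (ext E X)\<^esub> ehom E Y X"
    using right_imp(2)[OF oY oY oX g hYX id_closed[OF oY]] ehom_id[OF Y] hom[OF Y] by simp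
  then have le: "g \<sqsubseteq>\<^bsub>qhom Q (ext E Y) (ext E X)\<^esub> ehom E Y X"
    by (simp add: comp_id_right[OF oY oX g])
  have "ehom E Z Y = right_imp Q (ext E Z) (ext E Y) (ext E X) (ehom E Y X) (ehom E Z X)"
    if Z: "Z \<in> ob E" for Z
  proof (rule hom_le_antisym[OF ext_closed[OF Z] oY ehom_closed[OF Z Y]])
    note adj = right_imp[OF ext_closed[OF Z] oY oX hYX ehom_closed[OF Z X]]
    show "right_imp Q (ext E Z) (ext E Y) (ext E X) (ehom E Y X) (ehom E Z X)
        \<in> arrows Q (ext E Z) (ext E Y)"
      by (rule adj(1))
    show "ehom E Z Y \<sqsubseteq>\<^bsub>qhom Q (ext E Z) (ext E Y)\<^esub>
        right_imp Q (ext E Z) (ext E Y) (ext E X) (ehom E Y X) (ehom E Z X)"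
      using adj(2)[OF ehom_closed[OF Z Y]] ehom_comp[OF Z Y X] by simp
    show "right_imp Q (ext E Z) (ext E Y) (ext E X) (ehom E Y X) (ehom E Z X)
        \<sqsubseteq>\<^bsub>qhom Q (ext E Z) (ext E Y)\<^esub> ehom E Z Y"
      unfolding hom[OF Z]
      by (rule right_imp_antitone[OF ext_closed[OF Z] oY oX g hYX ehom_closed[OF Z X] le])
  qed
  then show ?thesis using Y by (simp add: is_cotensor_def)
qed

lemma tensor_by_hom:
  assumes X: "X \<in> ob E" and Y: "Y \<in> ob E"
    and f: "f \<in> arrows Q (ext E X) (ext E Y)"
    and c: "is_tensor Q E (ext E Y) f X Y"
  shows "is_tensor Q E (ext E Y) (ehom E X Y) X Y"
proof -
  have hom: "ehom E Y Z = left_imp Q (ext E X) (ext E Y) (ext E Z) (ehom E X Z) f"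
    if "Z \<in> ob E" for Z
    using c that by (simp add: is_tensor_def)
  note oX = ext_closed[OF X] and oY = ext_closed[OF Y] and hXY = ehom_closed[OF X Y]
  have "qcomp Q (ext E X) (ext E Y) (ext E Y) (qid Q (ext E Y)) f
      \<sqsubseteq>\<^bsub>qhom Q (ext E X) (ext E Y)\<^esub> ehom E X Y"
    using left_imp(2)[OF oX oY oY f hXY id_closed[OF oY]] ehom_id[OF Y] hom[OF Y] by simp
  then have le: "f \<sqsubseteq>\<^bsub>qhom Q (ext E X) (ext E Y)\<^esub> ehom E X Y"
    by (simp add: comp_id_left[OF oX oY f])
  have "ehom E Y Z = left_imp Q (ext E X) (ext E Y) (ext E Z) (ehom E X Z) (ehom E X Y)"
    if Z: "Z \<in> ob E" for Z
  proof (rule hom_le_antisym[OF oY ext_closed[OF Z] ehom_closed[OF Y Z]])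
    note adj = left_imp[OF oX oY ext_closed[OF Z] hXY ehom_closed[OF X Z]]
    show "left_imp Q (ext E X) (ext E Y) (ext E Z) (ehom E X Z) (ehom E X Y)
        \<in> arrows Q (ext E Y) (ext E Z)"
      by (rule adj(1))
    show "ehom E Y Z \<sqsubseteq>\<^bsub>qhom Q (ext E Y) (ext E Z)\<^esub>
        left_imp Q (ext E X) (ext E Y) (ext E Z) (ehom E X Z) (ehom E X Y)"
      using adj(2)[OF ehom_closed[OF Y Z]] ehom_comp[OF X Y Z] by simp
    show "left_imp Q (ext E X) (ext E Y) (ext E Z) (ehom E X Z) (ehom E X Y)
        \<sqsubseteq>\<^bsub>qhom Q (ext E Y) (ext E Z)\<^esub> ehom E Y Z"
      unfolding hom[OF Z]
      by (rule left_imp_antitone[OF oX oY ext_closed[OF Z] f hXY ehom_closed[OF X Z] le])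
  qed
  then show ?thesis using Y by (simp add: is_tensor_def)
qed

end

theorem proposition5p3:
  fixes Q :: "('o, 'a) quantaloid_data"
    and E :: "('e, 'o, 'a) qcategory_data"
    and X :: 'e
  assumes "quantaloid Q"
    and "qcategory Q E"
    and "X \<in> ob E"
  shows "(sierpinski Q E X \<longleftrightarrow>
            (\<forall>Y \<in> ob E. is_cotensor Q E (ext E Y) (ehom E Y X) X Y)) \<and>
         (co_sierpinski Q E X \<longleftrightarrow>
            (\<forall>Y \<in> ob E. is_tensor Q E (ext E Y) (ehom E X Y) X Y))"
proof -
  interpret qcategory Q E by (rule assms(2))
  note X = assms(3)
  show ?thesis
    unfolding sierpinski_iff_all_cotensors[OF X] co_sierpinski_iff_all_tensors[OF X]
    using cotensor_by_hom[OF X] tensor_by_hom[OF X] ehom_closed X by meson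
qed

end
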